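(* Let $f_1,f_2\in C^2(\mathcal O)$ be positive functions that are bounded away from zero on $\mathcal O$ and such that $f_1=f_2$ near $\partial\mathcal O$ (i.e. $f_1=f_2$ on $\mathcal O\setminus\mathcal O_0$ for some compact $\mathcal O_0\subset\mathcal O$). If $P_{D,f_1}=P_{D,f_2}$ as bounded linear operators on $L^2(\mathcal O)$ for some $D>0$, then $f_1=f_2$ on $\mathcal O$.
   Context: $\mathcal O\subset\mathbb R^d$, $d\ge1$, is a bounded convex open set with smooth boundary, normalised so that $vol(\mathcal O)=1$. $C^2(\mathcal O)$ is the space of functions whose partial derivatives up to order $2$ are uniformly continuous on $\mathcal O$. For such $f$ with $f\ge f_{min}>0$, let $\mathcal L_f\phi=\nabla\cdot(f\nabla\phi)$ with Neumann boundary conditions $\partial\phi/\partial\nu=0$ on $\partial\mathcal O$. It is self-adjoint on $L^2(\mathcal O)$ with $L^2(\mathcal O)$-orthonormal eigenfunctions $e_{j,f}$, $j\ge0$, $\mathcal L_fe_{j,f}=-\lambda_{j,f}e_{j,f}$, $e_{0,f}=1$, $0=\lambda_{0}<\lambda_{1,f}\le\lambda_{2,f}\le\dots\uparrow\infty$ (counted with multiplicity). For $t>0$, $P_{t,f}(\phi)=\sum_{j\ge0}e^{-t\lambda_{j,f}}e_{j,f}\langle e_{j,f},\phi\rangle_{L^2}$, $\phi\in L^2(\mathcal O)$, is the transition operator (heat semigroup) of the reflected diffusion with generator $\mathcal L_f$. *)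

theory Defs
  imports "HOL-Analysis.Analysis"
begin

section \<open>Partial derivatives, gradient, divergence\<close>

definition partial :: "'a::euclidean_space \<Rightarrow> ('a \<Rightarrow> real) \<Rightarrow> 'a \<Rightarrow> real" where
  "partial b u x = frechet_derivative u (at x) b"

definition gradient :: "('a::euclidean_space \<Rightarrow> real) \<Rightarrow> 'a \<Rightarrow> 'a" where
  "gradient u x = (\<Sum>b\<in>Basis. partial b u x *\<^sub>R b)"

definition divergence :: "('a::euclidean_space \<Rightarrow> 'a) \<Rightarrow> 'a \<Rightarrow> real" where
  "divergence V x = (\<Sum>b\<in>Basis. partial b (\<lambda>y. V y \<bullet> b) x)"

text \<open>
  \<open>Ck_unif k S\<close>: all partial derivatives up to order \<open>k\<close> are uniformly continuous on the
  open set \<open>S\<close>. Total differentiability is built in so that \<^const>\<open>partial\<close> is meaningful;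
  it is automatic once the first-order partial derivatives exist and are continuous.
\<close>

fun Ck_unif :: "nat \<Rightarrow> 'a::euclidean_space set \<Rightarrow> ('a \<Rightarrow> real) \<Rightarrow> bool" where
  "Ck_unif 0 S u \<longleftrightarrow> uniformly_continuous_on S u"
| "Ck_unif (Suc k) S u \<longleftrightarrow>
     uniformly_continuous_on S u \<and> u differentiable_on S \<and>
     (\<forall>b\<in>Basis. Ck_unif k S (partial b u))"

fun Ck_on :: "nat \<Rightarrow> 'a::euclidean_space set \<Rightarrow> ('a \<Rightarrow> real) \<Rightarrow> bool" where
  "Ck_on 0 S u \<longleftrightarrow> continuous_on S u"
| "Ck_on (Suc k) S u \<longleftrightarrow> u differentiable_on S \<and> (\<forall>b\<in>Basis. Ck_on k S (partial b u))"

definition smooth_on :: "'a::euclidean_space set \<Rightarrow> ('a \<Rightarrow> real) \<Rightarrow> bool" where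
  "smooth_on S u \<longleftrightarrow> (\<forall>k. Ck_on k S u)"


section \<open>Smooth boundary and outward normal\<close>

definition boundary_defining ::
  "'a::euclidean_space set \<Rightarrow> 'a \<Rightarrow> 'a set \<Rightarrow> ('a \<Rightarrow> real) \<Rightarrow> bool" where
  "boundary_defining \<Omega> x U r \<longleftrightarrow>
     open U \<and> x \<in> U \<and> smooth_on U r \<and> (\<forall>y\<in>U. gradient r y \<noteq> 0) \<and>
     \<Omega> \<inter> U = {y\<in>U. r y < 0} \<and> frontier \<Omega> \<inter> U = {y\<in>U. r y = 0}"

definition smooth_boundary :: "'a::euclidean_space set \<Rightarrow> bool" where
  "smooth_boundary \<Omega> \<longleftrightarrow> (\<forall>x\<in>frontier \<Omega>. \<exists>U r. boundary_defining \<Omega> x U r)"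

text \<open>The normal does not depend on the choice of the local defining function.\<close>

definition outward_unit_normal :: "'a::euclidean_space set \<Rightarrow> 'a \<Rightarrow> 'a \<Rightarrow> bool" where
  "outward_unit_normal \<Omega> x \<nu> \<longleftrightarrow>
     (\<exists>U r. boundary_defining \<Omega> x U r \<and> \<nu> = gradient r x /\<^sub>R norm (gradient r x))"

text \<open>
  For \<open>u\<close> in \<open>Ck_unif 2 \<Omega>\<close> the gradient extends continuously to the closure of \<open>\<Omega>\<close>. The limit
  below is the value of that extension at the boundary point \<open>x\<close>, paired with the normal.
\<close>

definition neumann_bc :: "'a::euclidean_space set \<Rightarrow> ('a \<Rightarrow> real) \<Rightarrow> bool" where
  "neumann_bc \<Omega> u \<longleftrightarrow>
     (\<forall>x\<in>frontier \<Omega>. \<forall>\<nu>. outward_unit_normal \<Omega> x \<nu> \<longrightarrow>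
        ((\<lambda>y. gradient u y \<bullet> \<nu>) \<longlongrightarrow> 0) (at x within \<Omega>))"


section \<open>Square integrable functions\<close>

text \<open>Elements of \<open>L\<^sup>2(\<Omega>)\<close> are represented by functions; equality is equality almost everywhere.\<close>

definition L2 :: "'a::euclidean_space set \<Rightarrow> ('a \<Rightarrow> real) set" where
  "L2 \<Omega> = {u. u \<in> borel_measurable (lebesgue_on \<Omega>) \<and>
              integrable (lebesgue_on \<Omega>) (\<lambda>x. (u x)\<^sup>2)}"

definition L2_inner :: "'a::euclidean_space set \<Rightarrow> ('a \<Rightarrow> real) \<Rightarrow> ('a \<Rightarrow> real) \<Rightarrow> real" where
  "L2_inner \<Omega> u v = (LINT x|lebesgue_on \<Omega>. u x * v x)"

definition L2_norm :: "'a::euclidean_space set \<Rightarrow> ('a \<Rightarrow> real) \<Rightarrow> real" where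
  "L2_norm \<Omega> u = sqrt (L2_inner \<Omega> u u)"

definition L2_eq :: "'a::euclidean_space set \<Rightarrow> ('a \<Rightarrow> real) \<Rightarrow> ('a \<Rightarrow> real) \<Rightarrow> bool" where
  "L2_eq \<Omega> u v \<longleftrightarrow> (AE x in lebesgue_on \<Omega>. u x = v x)"

definition L2_sums ::
  "'a::euclidean_space set \<Rightarrow> (nat \<Rightarrow> 'a \<Rightarrow> real) \<Rightarrow> ('a \<Rightarrow> real) \<Rightarrow> bool" where
  "L2_sums \<Omega> g s \<longleftrightarrow>
     s \<in> L2 \<Omega> \<and> (\<lambda>n. L2_norm \<Omega> (\<lambda>x. (\<Sum>j<n. g j x) - s x)) \<longlonglongrightarrow> 0"


section \<open>The Neumann spectral decomposition and the transition operator\<close>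

definition generator :: "('a::euclidean_space \<Rightarrow> real) \<Rightarrow> ('a \<Rightarrow> real) \<Rightarrow> 'a \<Rightarrow> real" where
  "generator f u = divergence (\<lambda>x. f x *\<^sub>R gradient u x)"

text \<open>
  The sequences \<open>e\<close>, \<open>l\<close> are the eigenfunctions and eigenvalues of the self-adjoint Neumann
  realisation of \<open>generator f\<close> on \<open>L\<^sup>2(\<Omega>)\<close>. That all eigenvalues are listed with multiplicity is
  expressed by completeness of the orthonormal system (the last clause). By elliptic regularity
  the eigenfunctions are classical up to the boundary when \<open>f\<close> is in \<open>Ck_unif 2 \<Omega>\<close>, bounded away
  from \<open>0\<close>, and \<open>\<Omega>\<close> is bounded with smooth boundary.
\<close>

definition neumann_eigensystem ::
  "'a::euclidean_space set \<Rightarrow> ('a \<Rightarrow> real) \<Rightarrow> (nat \<Rightarrow> 'a \<Rightarrow> real) \<Rightarrow> (nat \<Rightarrow> real) \<Rightarrow> bool" where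
  "neumann_eigensystem \<Omega> f e l \<longleftrightarrow>
     (\<forall>j. Ck_unif 2 \<Omega> (e j) \<and> neumann_bc \<Omega> (e j) \<and>
          (\<forall>x\<in>\<Omega>. generator f (e j) x = - l j * e j x)) \<and>
     (\<forall>x\<in>\<Omega>. e 0 x = 1) \<and>
     l 0 = 0 \<and> 0 < l 1 \<and> mono l \<and> filterlim l at_top sequentially \<and>
     (\<forall>i j. L2_inner \<Omega> (e i) (e j) = (if i = j then 1 else 0)) \<and>
     (\<forall>\<phi>\<in>L2 \<Omega>. (\<forall>j. L2_inner \<Omega> (e j) \<phi> = 0) \<longrightarrow> L2_eq \<Omega> \<phi> (\<lambda>x. 0))"

text \<open>
  The spectral series converges in \<open>L\<^sup>2(\<Omega>)\<close> by Bessel's inequality and the Riesz--Fischer theorem,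
  so the choice below only selects a representative of the almost-everywhere class of its sum.
\<close>

definition transition_op ::
  "'a::euclidean_space set \<Rightarrow> (nat \<Rightarrow> 'a \<Rightarrow> real) \<Rightarrow> (nat \<Rightarrow> real) \<Rightarrow> real \<Rightarrow>
     ('a \<Rightarrow> real) \<Rightarrow> 'a \<Rightarrow> real" where
  "transition_op \<Omega> e l t \<phi> =
     (SOME \<psi>. L2_sums \<Omega> (\<lambda>j x. exp (- t * l j) * e j x * L2_inner \<Omega> (e j) \<phi>) \<psi>)"

end

theory Submission
  imports Defs
begin

text \<open>
  Write \<open>P\<close> for the common transition operator and \<open>g = f1 - f2\<close>, a function with compact support in
  \<open>\<Omega>\<close>. The proof rests on the fact that \<open>P\<close> determines the generator on eigenfunctions, and that
  the eigenfunctions are complete.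

  The function \<open>\<lambda> \<mapsto> exp (- D * \<lambda>)\<close> is injective, so the eigenspaces of \<open>P\<close> are those of both
  generators, with the same eigenvalues. As each eigenspace is finite dimensional, every
  eigenfunction \<open>u = e1 j\<close> of the first generator is a finite combination of eigenfunctions of the second
  one with the same eigenvalue (lemma \<open>eigenfunction_of_equal_transition_ops\<close>). Both generators
  therefore agree on \<open>u\<close>, which says \<open>\<nabla>\<cdot>(g\<nabla>u) = 0\<close> on \<open>\<Omega>\<close>.

  Now multiply this equation by the coordinate function \<open>x \<bullet> b\<close> and integrate by parts twice. The
  compact support of \<open>g\<close> removes all boundary terms and leaves \<open>\<integral> u \<partial>\<^sub>b g = 0\<close> (lemma
  \<open>integral_mult_partial_eq_0\<close>): the continuous function \<open>\<partial>\<^sub>b g\<close> is orthogonal to all eigenfunctions.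
  By completeness it vanishes, for every direction \<open>b\<close>. Hence \<open>g\<close>, extended by zero, is a constant
  with compact support, which is zero.

  The transition operator is given by a choice of a sum of the spectral series, so one must know
  that this series converges in \<open>L\<^sup>2\<close> for every argument. This is the Riesz-Fischer theorem, proved
  from the completeness of \<open>L\<^sup>2\<close>; its consequence \<open>transition_op_coefficients\<close> is all that the
  spectral argument needs.
\<close>

section \<open>Inner product and norm of square integrable functions\<close>

lemma L2_mult_integrable:
  assumes "u \<in> L2 S" "v \<in> L2 S"
  shows "integrable (lebesgue_on S) (\<lambda>x. u x * v x)"
proof (rule Bochner_Integration.integrable_bound)
  show "integrable (lebesgue_on S) (\<lambda>x. (u x)\<^sup>2 + (v x)\<^sup>2)"
    using assms by (auto simp: L2_def)
  show "(\<lambda>x. u x * v x) \<in> borel_measurable (lebesgue_on S)"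
    using assms by (auto simp: L2_def)
  have "\<bar>u x * v x\<bar> \<le> (u x)\<^sup>2 + (v x)\<^sup>2" for x
  proof -
    have "0 \<le> (\<bar>u x\<bar> - \<bar>v x\<bar>)\<^sup>2" by simp
    then have "2 * \<bar>u x * v x\<bar> \<le> (u x)\<^sup>2 + (v x)\<^sup>2"
      by (simp add: power2_diff abs_mult)
    moreover have "0 \<le> (u x)\<^sup>2 + (v x)\<^sup>2" by simp
    ultimately show ?thesis by linarith
  qed
  then show "AE x in lebesgue_on S. norm (u x * v x) \<le> norm ((u x)\<^sup>2 + (v x)\<^sup>2)"
    by simp
qed

lemma L2_scale [intro]: "u \<in> L2 S \<Longrightarrow> (\<lambda>x. c * u x) \<in> L2 S"
  by (auto simp: L2_def power_mult_distrib)

lemma L2_add [intro]: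
  assumes "u \<in> L2 S" "v \<in> L2 S"
  shows "(\<lambda>x. u x + v x) \<in> L2 S"
  using assms L2_mult_integrable[OF assms] unfolding L2_def
  by (auto simp: power2_sum mult.assoc)

lemma L2_diff [intro]: "u \<in> L2 S \<Longrightarrow> v \<in> L2 S \<Longrightarrow> (\<lambda>x. u x - v x) \<in> L2 S"
  using L2_add[of u S "\<lambda>x. -1 * v x"] L2_scale[of v S "-1"] by simp

lemma L2_zero: "(\<lambda>x. 0) \<in> L2 S"
  by (auto simp: L2_def)

lemma L2_sum [intro]:
  assumes "\<And>j. j \<in> A \<Longrightarrow> g j \<in> L2 S"
  shows "(\<lambda>x. \<Sum>j\<in>A. g j x) \<in> L2 S"
proof (cases "finite A")
  case True
  then show ?thesis using assms
    by (induction A rule: finite_induct) (auto intro!: L2_add L2_zero)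
qed (auto intro: L2_zero)

lemma L2_inner_commute: "L2_inner S u v = L2_inner S v u"
  by (simp add: L2_inner_def mult.commute)

lemma L2_inner_scale_right: "L2_inner S u (\<lambda>x. c * v x) = c * L2_inner S u v"
  by (simp add: L2_inner_def mult.left_commute)

lemma L2_inner_diff_right:
  assumes "u \<in> L2 S" "v \<in> L2 S" "w \<in> L2 S"
  shows "L2_inner S u (\<lambda>x. v x - w x) = L2_inner S u v - L2_inner S u w"
  unfolding L2_inner_def
  using L2_mult_integrable[OF assms(1,2)] L2_mult_integrable[OF assms(1,3)]
  by (simp add: right_diff_distrib)

lemma L2_inner_sum_right:
  assumes "u \<in> L2 S" "\<And>j. j \<in> A \<Longrightarrow> g j \<in> L2 S"
  shows "L2_inner S u (\<lambda>x. \<Sum>j\<in>A. g j x) = (\<Sum>j\<in>A. L2_inner S u (g j))"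
  unfolding L2_inner_def sum_distrib_left
  by (rule Bochner_Integration.integral_sum) (use L2_mult_integrable assms in auto)

text \<open>
  Operators on \<open>L\<^sup>2\<close> are compared only almost everywhere; this carries such comparisons to coefficients.
\<close>

lemma L2_inner_cong_AE:
  assumes "u \<in> L2 S" "v \<in> L2 S" "w \<in> L2 S" "L2_eq S v w"
  shows "L2_inner S u v = L2_inner S u w"
  unfolding L2_inner_def
proof (rule Bochner_Integration.integral_cong_AE)
  show "AE x in lebesgue_on S. u x * v x = u x * w x"
    using assms(4) unfolding L2_eq_def by eventually_elim simp
qed (use assms in \<open>auto simp: L2_def\<close>)

lemma L2_inner_self_nonneg: "0 \<le> L2_inner S u u"
  by (simp add: L2_inner_def)

lemma L2_norm_nonneg: "0 \<le> L2_norm S u"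
  by (simp add: L2_norm_def L2_inner_self_nonneg)

lemma L2_norm_power2: "(L2_norm S u)\<^sup>2 = L2_inner S u u"
  by (simp add: L2_norm_def L2_inner_self_nonneg)

lemma L2_norm_minus_commute: "L2_norm S (\<lambda>x. u x - v x) = L2_norm S (\<lambda>x. v x - u x)"
  unfolding L2_norm_def L2_inner_def by (simp add: algebra_simps)

lemma nn_integral_square_eq_L2_norm:
  assumes "u \<in> L2 S"
  shows "(\<integral>\<^sup>+x. ennreal ((u x)\<^sup>2) \<partial>lebesgue_on S) = ennreal ((L2_norm S u)\<^sup>2)"
  using assms unfolding L2_norm_power2 L2_inner_def
  by (subst nn_integral_eq_integral) (auto simp: L2_def power2_eq_square)

text \<open>
  The inequality is kept for the integral of the absolute value, which is stronger than the
  usual one: with \<open>v = 1\<close> it bounds the \<open>L\<^sup>1\<close> norm by the \<open>L\<^sup>2\<close> norm.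
\<close>

lemma L2_Cauchy_Schwarz_nn:
  assumes "u \<in> L2 S" "v \<in> L2 S"
  shows "(\<integral>\<^sup>+x. ennreal \<bar>u x * v x\<bar> \<partial>lebesgue_on S) \<le> ennreal (L2_norm S u * L2_norm S v)"
proof -
  have [measurable]: "u \<in> borel_measurable (lebesgue_on S)" "v \<in> borel_measurable (lebesgue_on S)"
    using assms by (auto simp: L2_def)
  have "(\<integral>\<^sup>+x. ennreal \<bar>u x\<bar> * ennreal \<bar>v x\<bar> \<partial>lebesgue_on S)\<^sup>2
      \<le> (\<integral>\<^sup>+x. ennreal \<bar>u x\<bar> ^ 2 \<partial>lebesgue_on S) * (\<integral>\<^sup>+x. ennreal \<bar>v x\<bar> ^ 2 \<partial>lebesgue_on S)"
    by (rule Cauchy_Schwarz_nn_integral) measurable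
  also have "\<dots> = (ennreal (L2_norm S u * L2_norm S v))\<^sup>2"
    using nn_integral_square_eq_L2_norm[OF assms(1)] nn_integral_square_eq_L2_norm[OF assms(2)]
    by (simp add: ennreal_power ennreal_mult' [symmetric] power_mult_distrib L2_norm_nonneg)
  finally have sq: "(\<integral>\<^sup>+x. ennreal \<bar>u x * v x\<bar> \<partial>lebesgue_on S)\<^sup>2
      \<le> (ennreal (L2_norm S u * L2_norm S v))\<^sup>2"
    by (simp add: abs_mult ennreal_mult')
  have int: "(\<integral>\<^sup>+x. ennreal \<bar>u x * v x\<bar> \<partial>lebesgue_on S)
      = ennreal (LINT x|lebesgue_on S. \<bar>u x * v x\<bar>)"
    using L2_mult_integrable[OF assms] by (intro nn_integral_eq_integral) auto
  have "(LINT x|lebesgue_on S. \<bar>u x * v x\<bar>)\<^sup>2 \<le> (L2_norm S u * L2_norm S v)\<^sup>2"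
    using sq unfolding int by (simp add: ennreal_power L2_norm_nonneg)
  then have "(LINT x|lebesgue_on S. \<bar>u x * v x\<bar>) \<le> L2_norm S u * L2_norm S v"
    by (rule power2_le_imp_le) (simp add: L2_norm_nonneg)
  then show ?thesis unfolding int by (rule ennreal_leI)
qed

lemma L2_Cauchy_Schwarz:
  assumes "u \<in> L2 S" "v \<in> L2 S"
  shows "\<bar>L2_inner S u v\<bar> \<le> L2_norm S u * L2_norm S v"
proof -
  have "ennreal \<bar>L2_inner S u v\<bar> \<le> (\<integral>\<^sup>+x. ennreal (norm (u x * v x)) \<partial>lebesgue_on S)"
    unfolding L2_inner_def using integral_norm_bound_ennreal[OF L2_mult_integrable[OF assms]]
    by simp
  also have "\<dots> \<le> ennreal (L2_norm S u * L2_norm S v)"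
    using L2_Cauchy_Schwarz_nn[OF assms] by simp
  finally show ?thesis by (simp add: L2_norm_nonneg)
qed

section \<open>Completeness and norm convergence\<close>

text \<open>
  A Cauchy sequence has a subsequence \<open>F (r k)\<close> whose increments have norm at most \<open>2\<^sup>-\<^sup>k\<close>. As the
  measure is finite, the increments are summable in \<open>L\<^sup>1\<close> too, so their sum converges absolutely
  almost everywhere and the subsequence has a pointwise limit. Fatou's lemma turns the Cauchy
  estimate for \<open>F n - F (r k)\<close> into the same estimate for the distance of \<open>F n\<close> to this limit.
\<close>

lemma L2_complete:
  assumes fin: "emeasure lebesgue S < \<infinity>" "S \<in> sets lebesgue"
    and F: "\<And>n. F n \<in> L2 S"
    and Cauchy: "\<And>\<epsilon>. 0 < \<epsilon> \<Longrightarrow> \<exists>N. \<forall>m\<ge>N. \<forall>n\<ge>N. L2_norm S (\<lambda>x. F m x - F n x) \<le> \<epsilon>"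
  obtains s where "s \<in> L2 S" "(\<lambda>n. L2_norm S (\<lambda>x. F n x - s x)) \<longlonglongrightarrow> 0"
proof -
  let ?M = "lebesgue_on S"
  have [measurable]: "F n \<in> borel_measurable ?M" for n using F by (simp add: L2_def)
  have one: "(\<lambda>x. 1) \<in> L2 S"
    using fin by (auto simp: L2_def finite_measure.integrable_const finite_measureI emeasure_restrict_space less_top)
  have "\<forall>k. \<exists>N. \<forall>m\<ge>N. \<forall>n\<ge>N. L2_norm S (\<lambda>x. F m x - F n x) \<le> (1/2)^k"
    using Cauchy by simp
  then obtain N where N: "\<And>k m n. N k \<le> m \<Longrightarrow> N k \<le> n \<Longrightarrow> L2_norm S (\<lambda>x. F m x - F n x) \<le> (1/2)^k"
    by metis
  \<comment> \<open>The partial sums of \<open>N\<close> make \<open>r\<close> monotone; the summand \<open>k\<close> makes it unbounded.\<close>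
  define r where "r k = k + (\<Sum>i\<le>k. N i)" for k
  have rN: "N k \<le> r k" for k unfolding r_def by (simp add: trans_le_add2 lessThan_Suc_atMost[symmetric])
  have rk: "k \<le> r k" for k unfolding r_def by simp
  have rSuc: "r k \<le> r (Suc k)" for k unfolding r_def by simp
  define g where "g k x = F (r (Suc k)) x - F (r k) x" for k x
  have [measurable]: "g k \<in> borel_measurable ?M" for k unfolding g_def by measurable
  have gL2: "g k \<in> L2 S" for k unfolding g_def by (intro L2_diff F)
  have gnorm: "L2_norm S (g k) \<le> (1/2)^k" for k
    using N[of k "r (Suc k)" "r k"] rN[of k] rSuc[of k] unfolding g_def by simp
  have bound: "(\<integral>\<^sup>+x. ennreal \<bar>g k x\<bar> \<partial>?M) \<le> ennreal ((1/2)^k * L2_norm S (\<lambda>x. 1))" for k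
  proof -
    have "(\<integral>\<^sup>+x. ennreal \<bar>g k x\<bar> \<partial>?M) \<le> ennreal (L2_norm S (g k) * L2_norm S (\<lambda>x. 1))"
      using L2_Cauchy_Schwarz_nn[OF gL2[of k] one] by simp
    also have "\<dots> \<le> ennreal ((1/2)^k * L2_norm S (\<lambda>x. 1))"
      by (intro ennreal_leI mult_right_mono gnorm L2_norm_nonneg)
    finally show ?thesis .
  qed
  have "(\<integral>\<^sup>+x. (\<Sum>k. ennreal \<bar>g k x\<bar>) \<partial>?M) = (\<Sum>k. \<integral>\<^sup>+x. ennreal \<bar>g k x\<bar> \<partial>?M)"
    by (rule nn_integral_suminf) measurable
  also have "\<dots> \<le> (\<Sum>k. ennreal ((1/2)^k * L2_norm S (\<lambda>x. 1)))"
    by (intro suminf_le bound) auto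
  also have "\<dots> = ennreal (\<Sum>k. (1/2)^k * L2_norm S (\<lambda>x. 1))"
    by (intro suminf_ennreal2) (auto intro!: summable_mult2 mult_nonneg_nonneg L2_norm_nonneg)
  finally have "(\<integral>\<^sup>+x. (\<Sum>k. ennreal \<bar>g k x\<bar>) \<partial>?M) \<noteq> \<infinity>"
    using ennreal_less_top top.not_eq_extremum by (metis infinity_ennreal_def leD)
  then have "AE x in ?M. (\<Sum>k. ennreal \<bar>g k x\<bar>) \<noteq> \<infinity>"
    by (intro nn_integral_PInf_AE) measurable
  then have conv: "AE x in ?M. (\<lambda>k. F (r k) x) \<longlonglongrightarrow> lim (\<lambda>k. F (r k) x)"
  proof eventually_elim
    case (elim x)
    then have "summable (\<lambda>k. \<bar>g k x\<bar>)"
      by (intro summable_suminf_not_top) auto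
    then have "summable (\<lambda>k. g k x)" by (rule summable_rabs_cancel)
    then have "convergent (\<lambda>n. F (r n) x - F (r 0) x)"
      unfolding summable_iff_convergent g_def by (simp add: sum_lessThan_telescope[where f="\<lambda>k. F (r k) x"])
    then have "convergent (\<lambda>n. F (r n) x)"
      by (simp only: convergent_diff_const_right_iff)
    then show ?case by (simp add: convergent_LIMSEQ_iff)
  qed
  define s where "s x = lim (\<lambda>k. F (r k) x)" for x
  have [measurable]: "s \<in> borel_measurable ?M" unfolding s_def by measurable
  have Fatou: "(\<integral>\<^sup>+x. ennreal ((F n x - s x)\<^sup>2) \<partial>?M) \<le> ennreal (\<epsilon>\<^sup>2)"
    if n: "n \<ge> M" and M: "\<forall>m\<ge>M. \<forall>n\<ge>M. L2_norm S (\<lambda>x. F m x - F n x) \<le> \<epsilon>" for n M \<epsilon>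
  proof -
    have "(\<integral>\<^sup>+x. ennreal ((F n x - s x)\<^sup>2) \<partial>?M) = (\<integral>\<^sup>+x. liminf (\<lambda>k. ennreal ((F n x - F (r k) x)\<^sup>2)) \<partial>?M)"
    proof (rule nn_integral_cong_AE)
      show "AE x in ?M. ennreal ((F n x - s x)\<^sup>2) = liminf (\<lambda>k. ennreal ((F n x - F (r k) x)\<^sup>2))"
        using conv
      proof eventually_elim
        case (elim x)
        then have "(\<lambda>k. ennreal ((F n x - F (r k) x)\<^sup>2)) \<longlonglongrightarrow> ennreal ((F n x - s x)\<^sup>2)"
          unfolding s_def by (intro tendsto_ennrealI tendsto_intros)
        then show ?case by (metis lim_imp_Liminf trivial_limit_sequentially)
      qed
    qed
    also have "\<dots> \<le> liminf (\<lambda>k. \<integral>\<^sup>+x. ennreal ((F n x - F (r k) x)\<^sup>2) \<partial>?M)"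
      by (rule nn_integral_liminf) measurable
    also have "\<dots> \<le> ennreal (\<epsilon>\<^sup>2)"
    proof (rule Liminf_le)
      have "(\<integral>\<^sup>+x. ennreal ((F n x - F (r k) x)\<^sup>2) \<partial>?M) \<le> ennreal (\<epsilon>\<^sup>2)" if "k \<ge> M" for k
      proof -
        have "r k \<ge> M" using rk[of k] that by linarith
        then have "L2_norm S (\<lambda>x. F n x - F (r k) x) \<le> \<epsilon>" using M n by blast
        then have "(L2_norm S (\<lambda>x. F n x - F (r k) x))\<^sup>2 \<le> \<epsilon>\<^sup>2"
          using L2_norm_nonneg by (rule power_mono)
        then show ?thesis
          by (subst nn_integral_square_eq_L2_norm) (auto intro!: L2_diff F ennreal_leI)
      qed
      then show "\<forall>\<^sub>F k in sequentially. (\<integral>\<^sup>+x. ennreal ((F n x - F (r k) x)\<^sup>2) \<partial>?M) \<le> ennreal (\<epsilon>\<^sup>2)"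
        using eventually_sequentially by blast
    qed simp
    finally show ?thesis .
  qed
  have diffL2: "(\<lambda>x. F n x - s x) \<in> L2 S"
    if "n \<ge> M" "\<forall>m\<ge>M. \<forall>n\<ge>M. L2_norm S (\<lambda>x. F m x - F n x) \<le> \<epsilon>" for n M \<epsilon>
    using Fatou[OF that] unfolding L2_def
    by (auto intro!: integrableI_bounded simp: le_less_trans)
  obtain M1 where M1: "\<forall>m\<ge>M1. \<forall>n\<ge>M1. L2_norm S (\<lambda>x. F m x - F n x) \<le> 1"
    using Cauchy[of 1] by auto
  have sL2: "s \<in> L2 S"
    using L2_diff[OF F[of M1] diffL2[OF order_refl M1]] by simp
  have "(\<lambda>n. L2_norm S (\<lambda>x. F n x - s x)) \<longlonglongrightarrow> 0"
  proof (rule LIMSEQ_I)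
    fix \<epsilon> :: real assume "0 < \<epsilon>"
    then obtain M where M: "\<forall>m\<ge>M. \<forall>n\<ge>M. L2_norm S (\<lambda>x. F m x - F n x) \<le> \<epsilon>/2"
      using Cauchy[of "\<epsilon>/2"] by auto
    have "L2_norm S (\<lambda>x. F n x - s x) \<le> \<epsilon>/2" if "n \<ge> M" for n
    proof (rule power2_le_imp_le)
      show "(L2_norm S (\<lambda>x. F n x - s x))\<^sup>2 \<le> (\<epsilon>/2)\<^sup>2"
        using Fatou[OF that M] by (subst (asm) nn_integral_square_eq_L2_norm) (auto intro!: L2_diff F sL2)
    qed (use \<open>0 < \<epsilon>\<close> in simp)
    moreover have "\<epsilon>/2 < \<epsilon>" using \<open>0 < \<epsilon>\<close> by simp
    ultimately have "\<forall>n\<ge>M. L2_norm S (\<lambda>x. F n x - s x) < \<epsilon>"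
      using le_less_trans by blast
    then show "\<exists>no. \<forall>n\<ge>no. norm (L2_norm S (\<lambda>x. F n x - s x) - 0) < \<epsilon>"
      by (auto simp: abs_of_nonneg L2_norm_nonneg)
  qed
  with sL2 show ?thesis using that by blast
qed

text \<open>
  Norm convergence implies weak convergence, by the Cauchy-Schwarz inequality.
\<close>

lemma L2_sums_inner:
  assumes "\<And>j. g j \<in> L2 S" "v \<in> L2 S" "L2_sums S g s"
  shows "(\<lambda>j. L2_inner S v (g j)) sums L2_inner S v s"
proof -
  have s: "s \<in> L2 S" and lim: "(\<lambda>n. L2_norm S (\<lambda>x. (\<Sum>j<n. g j x) - s x)) \<longlonglongrightarrow> 0"
    using assms(3) by (auto simp: L2_sums_def)
  have "(\<lambda>n. (\<Sum>j<n. L2_inner S v (g j)) - L2_inner S v s) \<longlonglongrightarrow> 0"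
  proof (rule tendsto_0_le[where K = "L2_norm S v"])
    show "(\<lambda>n. L2_norm S (\<lambda>x. (\<Sum>j<n. g j x) - s x)) \<longlonglongrightarrow> 0" by (rule lim)
    have "\<bar>(\<Sum>j<n. L2_inner S v (g j)) - L2_inner S v s\<bar>
        \<le> L2_norm S v * L2_norm S (\<lambda>x. (\<Sum>j<n. g j x) - s x)" for n
    proof -
      have sm: "(\<lambda>x. \<Sum>j<n. g j x) \<in> L2 S" using assms(1) by (rule L2_sum)
      have "(\<Sum>j<n. L2_inner S v (g j)) - L2_inner S v s = L2_inner S v (\<lambda>x. (\<Sum>j<n. g j x) - s x)"
        using assms sm s by (simp add: L2_inner_diff_right L2_inner_sum_right)
      then show ?thesis using L2_Cauchy_Schwarz[OF assms(2) L2_diff[OF sm s]] by simp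
    qed
    then show "\<forall>\<^sub>F n in sequentially. norm ((\<Sum>j<n. L2_inner S v (g j)) - L2_inner S v s)
        \<le> norm (L2_norm S (\<lambda>x. (\<Sum>j<n. g j x) - s x)) * L2_norm S v"
      by (simp add: abs_of_nonneg L2_norm_nonneg mult.commute)
  qed
  then show ?thesis unfolding sums_def by (simp add: LIM_zero_iff)
qed

section \<open>Orthonormal series\<close>

definition L2_orthonormal :: "'a::euclidean_space set \<Rightarrow> (nat \<Rightarrow> 'a \<Rightarrow> real) \<Rightarrow> bool" where
  "L2_orthonormal S e \<longleftrightarrow>
     (\<forall>j. e j \<in> L2 S) \<and> (\<forall>i j. L2_inner S (e i) (e j) = (if i = j then 1 else 0))"

lemma orthonormal_inner_sum:
  assumes "L2_orthonormal S e" "finite A"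
  shows "L2_inner S (e k) (\<lambda>x. \<Sum>j\<in>A. c j * e j x) = (if k \<in> A then c k else 0)"
proof -
  have "L2_inner S (e k) (\<lambda>x. \<Sum>j\<in>A. c j * e j x) = (\<Sum>j\<in>A. L2_inner S (e k) (\<lambda>x. c j * e j x))"
    using assms(1) by (intro L2_inner_sum_right) (auto simp: L2_orthonormal_def)
  also have "\<dots> = (\<Sum>j\<in>A. if k = j then c j else 0)"
    using assms(1) by (intro sum.cong) (auto simp: L2_inner_scale_right L2_orthonormal_def)
  finally show ?thesis using assms(2) by simp
qed

lemma orthonormal_norm_sum:
  assumes "L2_orthonormal S e" "finite A"
  shows "(L2_norm S (\<lambda>x. \<Sum>j\<in>A. c j * e j x))\<^sup>2 = (\<Sum>j\<in>A. (c j)\<^sup>2)"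
proof -
  let ?s = "\<lambda>x. \<Sum>j\<in>A. c j * e j x"
  have e: "e j \<in> L2 S" for j using assms by (auto simp: L2_orthonormal_def)
  have "L2_inner S ?s ?s = (\<Sum>j\<in>A. L2_inner S ?s (\<lambda>x. c j * e j x))"
    by (intro L2_inner_sum_right L2_sum L2_scale e)
  also have "\<dots> = (\<Sum>j\<in>A. (c j)\<^sup>2)"
    using orthonormal_inner_sum[OF assms]
    by (intro sum.cong) (auto simp: L2_inner_scale_right L2_inner_commute[of S ?s] power2_eq_square)
  finally show ?thesis by (simp add: L2_norm_power2)
qed

text \<open>
  Expand the square of the distance of \<open>\<phi>\<close> to its partial Fourier sum, which is nonnegative.
\<close>

lemma Bessel_inequality:
  assumes "L2_orthonormal S e" "\<phi> \<in> L2 S"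
  shows "summable (\<lambda>j. (L2_inner S (e j) \<phi>)\<^sup>2)"
proof (rule summableI_nonneg_bounded)
  fix n
  define c where "c j = L2_inner S (e j) \<phi>" for j
  let ?s = "\<lambda>x. \<Sum>j<n. c j * e j x"
  have e: "e j \<in> L2 S" for j using assms by (auto simp: L2_orthonormal_def)
  have sL2: "?s \<in> L2 S" by (intro L2_sum L2_scale e)
  have sphi: "L2_inner S \<phi> ?s = (\<Sum>j<n. (c j)\<^sup>2)"
    using e assms(2) by (subst L2_inner_sum_right)
      (auto simp: L2_inner_scale_right c_def L2_inner_commute[of S \<phi>] power2_eq_square)
  have "0 \<le> L2_inner S (\<lambda>x. \<phi> x - ?s x) (\<lambda>x. \<phi> x - ?s x)" by (rule L2_inner_self_nonneg)
  also have "\<dots> = L2_inner S \<phi> \<phi> - 2 * L2_inner S \<phi> ?s + L2_inner S ?s ?s"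
  proof -
    have "L2_inner S (\<lambda>x. \<phi> x - ?s x) (\<lambda>x. \<phi> x - ?s x)
        = L2_inner S (\<lambda>x. \<phi> x - ?s x) \<phi> - L2_inner S (\<lambda>x. \<phi> x - ?s x) ?s"
      using assms(2) sL2 by (intro L2_inner_diff_right L2_diff)
    moreover have "L2_inner S (\<lambda>x. \<phi> x - ?s x) \<phi> = L2_inner S \<phi> \<phi> - L2_inner S \<phi> ?s"
      by (subst L2_inner_commute) (rule L2_inner_diff_right[OF assms(2,2) sL2])
    moreover have "L2_inner S (\<lambda>x. \<phi> x - ?s x) ?s = L2_inner S ?s \<phi> - L2_inner S ?s ?s"
      by (subst L2_inner_commute) (rule L2_inner_diff_right[OF sL2 assms(2) sL2])
    ultimately show ?thesis using L2_inner_commute[of S ?s \<phi>] by linarith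
  qed
  also have "L2_inner S ?s ?s = (\<Sum>j<n. (c j)\<^sup>2)"
    using orthonormal_norm_sum[OF assms(1), of "{..<n}" c] by (simp add: L2_norm_power2)
  finally show "(\<Sum>j<n. (L2_inner S (e j) \<phi>)\<^sup>2) \<le> L2_inner S \<phi> \<phi>"
    using sphi by (simp add: c_def)
qed simp

lemma Riesz_Fischer:
  assumes "emeasure lebesgue S < \<infinity>" "S \<in> sets lebesgue"
    and on: "L2_orthonormal S e" and c: "summable (\<lambda>j. (c j)\<^sup>2)"
  obtains s where "L2_sums S (\<lambda>j x. c j * e j x) s"
proof -
  have e: "e j \<in> L2 S" for j using on by (auto simp: L2_orthonormal_def)
  have "\<exists>N. \<forall>m\<ge>N. \<forall>n\<ge>N. L2_norm S (\<lambda>x. (\<Sum>j<m. c j * e j x) - (\<Sum>j<n. c j * e j x)) \<le> \<epsilon>"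
    if "0 < \<epsilon>" for \<epsilon>
  proof -
    have "0 < \<epsilon>\<^sup>2" using that by simp
    then obtain N where N: "\<And>m n. m \<ge> N \<Longrightarrow> norm (\<Sum>j\<in>{m..<n}. (c j)\<^sup>2) < \<epsilon>\<^sup>2"
      using c unfolding summable_Cauchy by blast
    have *: "L2_norm S (\<lambda>x. (\<Sum>j<n. c j * e j x) - (\<Sum>j<m. c j * e j x)) \<le> \<epsilon>"
      if "N \<le> m" "m \<le> n" for m n
    proof (rule power2_le_imp_le)
      have "(\<lambda>x. (\<Sum>j<n. c j * e j x) - (\<Sum>j<m. c j * e j x)) = (\<lambda>x. \<Sum>j\<in>{m..<n}. c j * e j x)"
        using that(2) by (simp add: lessThan_atLeast0 sum_diff_nat_ivl)
      then show "(L2_norm S (\<lambda>x. (\<Sum>j<n. c j * e j x) - (\<Sum>j<m. c j * e j x)))\<^sup>2 \<le> \<epsilon>\<^sup>2"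
        using N[OF that(1), of n] orthonormal_norm_sum[OF on, of "{m..<n}" c] by simp
    qed (use \<open>0 < \<epsilon>\<close> in simp)
    show ?thesis
    proof (intro exI allI impI)
      fix m n assume "N \<le> m" "N \<le> n"
      then show "L2_norm S (\<lambda>x. (\<Sum>j<m. c j * e j x) - (\<Sum>j<n. c j * e j x)) \<le> \<epsilon>"
        using *[of m n] *[of n m]
          L2_norm_minus_commute[of S "\<lambda>x. \<Sum>j<m. c j * e j x" "\<lambda>x. \<Sum>j<n. c j * e j x"]
        by (cases "m \<le> n") auto
    qed
  qed
  moreover have "(\<lambda>x. \<Sum>j<n. c j * e j x) \<in> L2 S" for n by (intro L2_sum L2_scale e)
  ultimately obtain s where "s \<in> L2 S"
    "(\<lambda>n. L2_norm S (\<lambda>x. (\<Sum>j<n. c j * e j x) - s x)) \<longlonglongrightarrow> 0"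
    using L2_complete[OF assms(1,2), of "\<lambda>n x. \<Sum>j<n. c j * e j x"] by blast
  then show ?thesis using that by (auto simp: L2_sums_def)
qed

section \<open>Continuous representatives\<close>

text \<open>
  The set where two continuous functions differ is open, and a nonempty open set is not negligible.
\<close>

lemma L2_eq_continuous_imp_eq:
  assumes "open S" "continuous_on S u" "continuous_on S v" "L2_eq S u v" "x \<in> S"
  shows "u x = v x"
proof (rule ccontr)
  assume ne: "u x \<noteq> v x"
  let ?N = "{x \<in> S. u x - v x \<in> - {0}}"
  have "open (S \<inter> (\<lambda>x. u x - v x) -` (- {0}))"
    using assms(1-3) by (intro continuous_open_preimage continuous_on_diff) auto
  then have "open ?N" by (simp add: vimage_def Int_def)
  moreover have "AE x in lebesgue. x \<in> S \<longrightarrow> u x = v x"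
    using assms(1,4) unfolding L2_eq_def by (simp add: AE_restrict_space_iff)
  then have "negligible ?N"
    unfolding negligible_iff_null_sets completion.AE_iff_null_sets
    by (auto simp: AE_iff_null_sets eventually_ae_filter intro: completion.complete2)
  ultimately show False using ne assms(5) open_not_negligible[of ?N] by auto
qed

lemma uniformly_continuous_imp_L2:
  fixes u :: "'a::euclidean_space \<Rightarrow> real"
  assumes "open S" "bounded S" "uniformly_continuous_on S u"
  shows "u \<in> L2 S"
proof -
  have u: "u \<in> borel_measurable (lebesgue_on S)"
    using assms by (intro continuous_imp_measurable_on_sets_lebesgue uniformly_continuous_imp_continuous) auto
  obtain B where B: "\<And>x. x \<in> S \<Longrightarrow> \<bar>u x\<bar> \<le> B"
    using bounded_uniformly_continuous_image[OF assms(3,2)] by (auto simp: bounded_iff)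
  have fin: "emeasure (lebesgue_on S) (space (lebesgue_on S)) < \<infinity>"
    using assms(1,2) by (simp add: emeasure_restrict_space emeasure_bounded_finite flip: infinity_ennreal_def)
  have "integrable (lebesgue_on S) (\<lambda>x. (u x)\<^sup>2)"
  proof (rule finite_measure.integrable_const_bound)
    show "finite_measure (lebesgue_on S)" using fin by (intro finite_measureI) simp
    show "AE x in lebesgue_on S. norm ((u x)\<^sup>2) \<le> B\<^sup>2"
      using B by (intro AE_I2) (auto intro: abs_le_square_iff[THEN iffD1] order_trans[OF _ abs_ge_self])
  qed (use u in measurable)
  then show ?thesis using u by (simp add: L2_def)
qed

section \<open>Partial derivatives and the generator\<close>

lemma has_derivative_imp_partial:
  "(u has_derivative u') (at x) \<Longrightarrow> partial b u x = u' b"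
  unfolding partial_def using frechet_derivative_at by metis

text \<open>
  No differentiability is assumed: the two functions have the same derivatives at \<open>x\<close>, so the
  choice hidden in \<^const>\<open>frechet_derivative\<close> is made from the same set. Thus a function may be
  replaced under a partial derivative by any function equal to it on an open set.
\<close>

lemma partial_cong_open:
  assumes "open S" "x \<in> S" "\<And>y. y \<in> S \<Longrightarrow> u y = v y"
  shows "partial b u x = partial b v x"
proof -
  have "(u has_derivative D) (at x) \<longleftrightarrow> (v has_derivative D) (at x)" for D
    using assms has_derivative_transform_within_open by metis
  then show ?thesis by (simp add: partial_def frechet_derivative_def)
qed

lemma has_derivative_partial:
  assumes "u differentiable (at x)"
  shows "(u has_derivative (\<lambda>h. frechet_derivative u (at x) h)) (at x)"
  using assms frechet_derivative_works by blast

lemma partial_mult: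
  assumes "u differentiable (at x)" "v differentiable (at x)"
  shows "partial b (\<lambda>y. u y * v y) x = u x * partial b v x + partial b u x * v x"
  using has_derivative_imp_partial[OF has_derivative_mult[OF has_derivative_partial[OF assms(1)] has_derivative_partial[OF assms(2)]]]
  by (simp add: partial_def)

lemma partial_diff:
  assumes "u differentiable (at x)" "v differentiable (at x)"
  shows "partial b (\<lambda>y. u y - v y) x = partial b u x - partial b v x"
  using has_derivative_imp_partial[OF has_derivative_diff[OF has_derivative_partial[OF assms(1)] has_derivative_partial[OF assms(2)]]]
  by (simp add: partial_def)

lemma partial_sum_scale:
  assumes "\<And>k. k \<in> A \<Longrightarrow> v k differentiable (at x)"
  shows "partial b (\<lambda>y. \<Sum>k\<in>A. c k * v k y) x = (\<Sum>k\<in>A. c k * partial b (v k) x)"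
proof -
  have "((\<lambda>y. \<Sum>k\<in>A. c k * v k y) has_derivative (\<lambda>h. \<Sum>k\<in>A. c k * frechet_derivative (v k) (at x) h)) (at x)"
    by (intro has_derivative_sum has_derivative_mult_right has_derivative_partial assms)
  then show ?thesis by (subst has_derivative_imp_partial) (auto simp: partial_def)
qed

lemma partial_inner: "partial c (\<lambda>y. y \<bullet> b) x = c \<bullet> b"
  by (rule has_derivative_imp_partial) (auto intro!: derivative_eq_intros)

lemma generator_eq_sum_partial:
  "generator f u x = (\<Sum>c\<in>Basis. partial c (\<lambda>y. f y * partial c u y) x)"
  unfolding generator_def divergence_def gradient_def by simp

lemma Ck_on_1_mult:
  assumes "open S" "Ck_on 1 S u" "Ck_on 1 S v"
  shows "Ck_on 1 S (\<lambda>y. u y * v y)"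
proof -
  have u: "u differentiable_on S" "\<And>b. b \<in> Basis \<Longrightarrow> continuous_on S (partial b u)"
    and v: "v differentiable_on S" "\<And>b. b \<in> Basis \<Longrightarrow> continuous_on S (partial b v)"
    using assms by auto
  have "continuous_on S (partial b (\<lambda>y. u y * v y))" if "b \<in> Basis" for b
  proof -
    have "continuous_on S (\<lambda>x. u x * partial b v x + partial b u x * v x)"
      using u(2)[OF that] v(2)[OF that] u(1) v(1)
      by (intro continuous_on_add continuous_on_mult) (auto intro: differentiable_imp_continuous_on)
    then show ?thesis
      using u(1) v(1) assms(1)
      by (subst continuous_on_cong[OF refl partial_mult]) (auto simp: differentiable_on_eq_differentiable_at)
  qed
  then show ?thesis using u v by (auto intro: differentiable_on_mult)
qed

lemma Ck_on_1_diff: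
  assumes "open S" "Ck_on 1 S u" "Ck_on 1 S v"
  shows "Ck_on 1 S (\<lambda>y. u y - v y)"
proof -
  have u: "u differentiable_on S" "\<And>b. b \<in> Basis \<Longrightarrow> continuous_on S (partial b u)"
    and v: "v differentiable_on S" "\<And>b. b \<in> Basis \<Longrightarrow> continuous_on S (partial b v)"
    using assms by auto
  have "continuous_on S (partial b (\<lambda>y. u y - v y))" if "b \<in> Basis" for b
  proof -
    have "continuous_on S (\<lambda>x. partial b u x - partial b v x)"
      using u v that by (intro continuous_intros) auto
    then show ?thesis
      using u(1) v(1) assms(1)
      by (subst continuous_on_cong[OF refl partial_diff]) (auto simp: differentiable_on_eq_differentiable_at)
  qed
  then show ?thesis using u v by (auto intro: differentiable_on_diff)
qed

lemma Ck_on_1_inner: "Ck_on 1 S (\<lambda>y. y \<bullet> b)"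
proof -
  have "partial c (\<lambda>y. y \<bullet> b) = (\<lambda>y. c \<bullet> b)" for c using partial_inner by blast
  then show ?thesis by (auto simp: differentiable_on_def intro!: derivative_intros)
qed

lemma Ck_unif_2D:
  assumes "Ck_unif 2 S u"
  shows "uniformly_continuous_on S u" "Ck_on 1 S u"
    "b \<in> Basis \<Longrightarrow> uniformly_continuous_on S (partial b u)"
    "b \<in> Basis \<Longrightarrow> Ck_on 1 S (partial b u)"
  using assms by (auto simp: numeral_2_eq_2 uniformly_continuous_imp_continuous)

lemma Ck_on_1_differentiable:
  "open S \<Longrightarrow> Ck_on 1 S u \<Longrightarrow> x \<in> S \<Longrightarrow> u differentiable (at x)"
  by (auto simp: differentiable_on_eq_differentiable_at)

lemma generator_diff:
  assumes S: "open S" "x \<in> S" and f: "Ck_on 1 S f1" "Ck_on 1 S f2"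
    and u: "\<And>c. c \<in> Basis \<Longrightarrow> Ck_on 1 S (partial c u)"
  shows "generator (\<lambda>y. f1 y - f2 y) u x = generator f1 u x - generator f2 u x"
  unfolding generator_eq_sum_partial sum_subtractf[symmetric]
proof (rule sum.cong)
  fix c :: 'a assume c: "c \<in> Basis"
  have "(\<lambda>y. f1 y * partial c u y) differentiable (at x)"
       "(\<lambda>y. f2 y * partial c u y) differentiable (at x)"
    by (intro Ck_on_1_differentiable[OF S(1) _ S(2)] Ck_on_1_mult S f u c)+
  from partial_diff[OF this]
  show "partial c (\<lambda>y. (f1 y - f2 y) * partial c u y) x =
      partial c (\<lambda>y. f1 y * partial c u y) x - partial c (\<lambda>y. f2 y * partial c u y) x"
    by (simp add: left_diff_distrib)
qed simp

text \<open>
  The generator is linear and local: it suffices that \<open>u\<close> agrees with the linear combination on an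
  open set around \<open>x\<close>.
\<close>

lemma generator_sum_scale:
  assumes S: "open S" "x \<in> S" and f: "Ck_on 1 S f"
    and v: "\<And>k. k \<in> A \<Longrightarrow> Ck_on 1 S (v k)"
      "\<And>k c. k \<in> A \<Longrightarrow> c \<in> Basis \<Longrightarrow> Ck_on 1 S (partial c (v k))"
    and u: "\<And>y. y \<in> S \<Longrightarrow> u y = (\<Sum>k\<in>A. a k * v k y)"
  shows "generator f u x = (\<Sum>k\<in>A. a k * generator f (v k) x)"
proof -
  have "partial c (\<lambda>y. f y * partial c u y) x = (\<Sum>k\<in>A. a k * partial c (\<lambda>y. f y * partial c (v k) y) x)"
    if c: "c \<in> Basis" for c
  proof -
    have "f y * partial c u y = (\<Sum>k\<in>A. a k * (f y * partial c (v k) y))" if y: "y \<in> S" for y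
    proof -
      have "partial c u y = partial c (\<lambda>y. \<Sum>k\<in>A. a k * v k y) y"
        using S(1) y u by (rule partial_cong_open)
      also have "\<dots> = (\<Sum>k\<in>A. a k * partial c (v k) y)"
        by (intro partial_sum_scale Ck_on_1_differentiable[OF S(1) _ y] v)
      finally show ?thesis by (simp add: sum_distrib_left mult.left_commute)
    qed
    then have "partial c (\<lambda>y. f y * partial c u y) x
        = partial c (\<lambda>y. \<Sum>k\<in>A. a k * (f y * partial c (v k) y)) x"
      by (rule partial_cong_open[OF S])
    also have "\<dots> = (\<Sum>k\<in>A. a k * partial c (\<lambda>y. f y * partial c (v k) y) x)"
      by (intro partial_sum_scale Ck_on_1_differentiable[OF S(1) _ S(2)] Ck_on_1_mult S f v c)
    finally show ?thesis .
  qed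
  then have "generator f u x = (\<Sum>c\<in>Basis. \<Sum>k\<in>A. a k * partial c (\<lambda>y. f y * partial c (v k) y) x)"
    unfolding generator_eq_sum_partial by simp
  also have "\<dots> = (\<Sum>k\<in>A. \<Sum>c\<in>Basis. a k * partial c (\<lambda>y. f y * partial c (v k) y) x)"
    by (rule sum.swap)
  finally show ?thesis unfolding generator_eq_sum_partial by (simp add: sum_distrib_left)
qed

section \<open>Integration by parts with compact support\<close>

text \<open>
  This is the divergence theorem without boundary. Extend \<open>w\<close> by zero to a function \<open>W\<close> on the
  whole space. By translation invariance every difference quotient of \<open>W\<close> in the direction \<open>b\<close> has
  integral zero. The mean value theorem bounds the quotients uniformly, and they vanish outside a
  fixed ball, so dominated convergence gives the same for their limit \<open>G\<close>, the derivative of \<open>W\<close>.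
\<close>

lemma has_bochner_integral_partial_compact_support:
  fixes w :: "'a::euclidean_space \<Rightarrow> real"
  assumes "open S" "compact K" "K \<subseteq> S" and b: "b \<in> Basis"
    and w: "Ck_on 1 S w" and supp: "\<And>x. x \<in> S - K \<Longrightarrow> w x = 0"
  shows "has_bochner_integral (lebesgue_on S) (partial b w) 0"
proof -
  define W where "W x = (if x \<in> S then w x else 0)" for x
  define G where "G x = (if x \<in> K then partial b w x else 0)" for x
  have W0: "W x = 0" if "x \<notin> K" for x using supp that by (auto simp: W_def)
  have openK: "open (- K)" using assms(2) compact_imp_closed by blast
  have Gw: "partial b w x = G x" if "x \<in> S" for x
  proof (cases "x \<in> K")
    case False
    have "partial b w x = partial b (\<lambda>x. 0) x"
    proof (rule partial_cong_open)
      show "open (S - K)" using assms(1,2) compact_imp_closed by blast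
    qed (use False that supp in auto)
    also have "\<dots> = 0" by (rule has_derivative_imp_partial) auto
    finally show ?thesis using False by (simp add: G_def)
  qed (simp add: G_def)
  have W: "\<exists>W'. (W has_derivative W') (at x) \<and> W' b = G x" for x
  proof (cases "x \<in> S")
    case True
    have "(w has_derivative frechet_derivative w (at x)) (at x)"
      using Ck_on_1_differentiable[OF assms(1) w True] by (rule has_derivative_partial)
    then have "(W has_derivative frechet_derivative w (at x)) (at x)"
      by (rule has_derivative_transform_within_open[OF _ assms(1) True]) (simp add: W_def)
    then show ?thesis using Gw[OF True] by (auto simp: partial_def)
  next
    case False
    then have x: "x \<in> - K" using assms(3) by auto
    have "((\<lambda>x. 0) has_derivative (\<lambda>h. 0)) (at x)" by simp
    then have "(W has_derivative (\<lambda>h. 0)) (at x)"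
      by (rule has_derivative_transform_within_open[OF _ openK x]) (simp add: W0)
    then show ?thesis using x by (auto simp: G_def)
  qed
  have line: "((\<lambda>t. W (x + t *\<^sub>R b)) has_real_derivative G (x + t *\<^sub>R b)) (at t)" for x t
  proof -
    obtain W' where W': "(W has_derivative W') (at (x + t *\<^sub>R b))" "W' b = G (x + t *\<^sub>R b)"
      using W by blast
    have "((\<lambda>t. x + t *\<^sub>R b) has_derivative (\<lambda>h. h *\<^sub>R b)) (at t)"
      by (auto intro!: derivative_eq_intros)
    from has_derivative_compose[OF this W'(1)]
    have "((\<lambda>t. W (x + t *\<^sub>R b)) has_derivative (\<lambda>h. W' (h *\<^sub>R b))) (at t)" .
    moreover have "W' (h *\<^sub>R b) = G (x + t *\<^sub>R b) * h" for h
      using W' linear_scale[OF has_derivative_linear[OF W'(1)]] by simp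
    ultimately show ?thesis by (simp add: has_field_derivative_def)
  qed
  have "continuous_on K (partial b w)"
    using w b assms(3) by (auto intro: continuous_on_subset)
  then have "bounded (partial b w ` K)"
    using assms(2) compact_continuous_image compact_imp_bounded by blast
  then obtain M where M: "M > 0" "\<And>x. x \<in> K \<Longrightarrow> \<bar>partial b w x\<bar> \<le> M"
    by (auto simp: bounded_pos)
  then have GM: "\<bar>G x\<bar> \<le> M" for x by (auto simp: G_def)
  \<comment> \<open>The difference quotient of step \<open>1 / (n + 1)\<close>; steps at most 1 keep its support within distance 1 of \<open>K\<close>.\<close>
  define q where "q n x = real (Suc n) * (W (x + (1 / real (Suc n)) *\<^sub>R b) - W x)" for n x
  have qlim: "(\<lambda>n. q n x) \<longlonglongrightarrow> G x" for x
  proof -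
    have "((\<lambda>h. (W (x + (0 + h) *\<^sub>R b) - W (x + 0 *\<^sub>R b)) / h) \<longlongrightarrow> G (x + 0 *\<^sub>R b)) (at 0)"
      using line[of x 0] unfolding DERIV_def .
    then have "((\<lambda>h. (W (x + h *\<^sub>R b) - W x) / h) \<longlongrightarrow> G x) (at 0)" by simp
    moreover have "filterlim (\<lambda>n. 1 / real (Suc n)) (at 0) sequentially"
      unfolding filterlim_at using LIMSEQ_inverse_real_of_nat by (simp add: inverse_eq_divide)
    ultimately have "(\<lambda>n. (W (x + (1 / real (Suc n)) *\<^sub>R b) - W x) / (1 / real (Suc n))) \<longlonglongrightarrow> G x"
      by (rule filterlim_compose)
    then show ?thesis by (simp add: q_def mult.commute)
  qed
  have qbound: "\<bar>q n x\<bar> \<le> M" for n x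
  proof -
    define h where "h = 1 / real (Suc n)"
    have h: "0 < h" "real (Suc n) * h = 1" by (auto simp: h_def)
    obtain z where "W (x + h *\<^sub>R b) - W (x + 0 *\<^sub>R b) = (h - 0) * G (x + z *\<^sub>R b)"
      using MVT2[of 0 h "\<lambda>t. W (x + t *\<^sub>R b)" "\<lambda>t. G (x + t *\<^sub>R b)"] h(1) line by blast
    then have "q n x = (real (Suc n) * h) * G (x + z *\<^sub>R b)"
      unfolding q_def h_def by simp
    then show ?thesis unfolding h(2) using GM by simp
  qed
  obtain R where R: "\<And>x. x \<in> K \<Longrightarrow> norm x \<le> R"
    using assms(2) compact_imp_bounded bounded_iff by metis
  have qsupp: "q n x = 0" if "x \<notin> cball 0 (R + 1)" for n x
  proof -
    have nx: "norm x > R + 1" using that by (simp add: not_le)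
    then have "x \<notin> K" using R[of x] by auto
    moreover have "norm ((1 / real (Suc n)) *\<^sub>R b) \<le> 1" using b by simp
    then have "norm (x + (1 / real (Suc n)) *\<^sub>R b) > R"
      using nx norm_diff_ineq[of x "(1 / real (Suc n)) *\<^sub>R b"] by linarith
    then have "x + (1 / real (Suc n)) *\<^sub>R b \<notin> K" using R by force
    ultimately show ?thesis by (simp add: q_def W0)
  qed
  have contW: "continuous_on UNIV W"
    using W has_derivative_continuous continuous_at_imp_continuous_on by blast
  have [measurable]: "W \<in> borel_measurable borel" using contW by (rule borel_measurable_continuous_onI)
  have "integrable lborel (\<lambda>x. indicator K x *\<^sub>R W x)"
    using contW by (intro borel_integrable_compact assms) (auto intro: continuous_on_subset)
  moreover have "(\<lambda>x. indicator K x *\<^sub>R W x) = W" by (rule ext) (auto simp: indicator_def W0)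
  ultimately have intW: "integrable lborel W" by simp
  have shift: "has_bochner_integral lborel (\<lambda>x. W (x + a)) (integral\<^sup>L lborel W)" for a
  proof -
    have d: "distr lborel borel ((+) a) = lborel" by (rule lborel_distr_plus)
    have "integrable (distr lborel borel ((+) a)) W" using intW d by simp
    then have "integrable lborel (\<lambda>x. W (a + x))" by (subst (asm) integrable_distr_eq) auto
    moreover have "integral\<^sup>L (distr lborel borel ((+) a)) W = integral\<^sup>L lborel (\<lambda>x. W (a + x))"
      by (rule integral_distr) auto
    ultimately show ?thesis using d by (simp add: has_bochner_integral_iff add.commute)
  qed
  have q0: "has_bochner_integral lborel (q n) 0" for n
  proof -
    have "has_bochner_integral lborel (q n)
       (real (Suc n) * (integral\<^sup>L lborel W - integral\<^sup>L lborel W))"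
      unfolding q_def using intW shift
      by (intro has_bochner_integral_mult_right has_bochner_integral_diff)
        (auto simp: has_bochner_integral_iff)
    then show ?thesis by simp
  qed
  have [measurable]: "q n \<in> borel_measurable borel" for n unfolding q_def by measurable
  have [measurable]: "G \<in> borel_measurable borel"
    using qlim by (rule borel_measurable_LIMSEQ_real) measurable
  let ?d = "\<lambda>x. indicator (cball 0 (R + 1)) x *\<^sub>R M"
  have d: "integrable lborel ?d"
    by (intro borel_integrable_compact) auto
  have bd: "AE x in lborel. norm (q n x) \<le> ?d x" for n
    using qbound qsupp by (auto simp: indicator_def)
  have G: "integrable lborel G"
    by (rule integrable_dominated_convergence[where s=q and w="?d"]) (use d bd qlim in auto)
  have "(\<lambda>n. integral\<^sup>L lborel (q n)) \<longlonglongrightarrow> integral\<^sup>L lborel G"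
    by (rule integral_dominated_convergence[where w="?d"]) (use d bd qlim in auto)
  moreover have "(\<lambda>n. integral\<^sup>L lborel (q n)) = (\<lambda>n. 0)"
    using q0 by (auto simp: has_bochner_integral_iff)
  ultimately have "integral\<^sup>L lborel G = 0" using LIMSEQ_unique tendsto_const by metis
  with G have "has_bochner_integral lebesgue G 0"
    by (simp add: has_bochner_integral_iff integrable_completion integral_completion)
  moreover have "(\<lambda>x. indicator S x *\<^sub>R G x) = G"
    using assms(3) by (intro ext) (auto simp: indicator_def G_def)
  ultimately have "has_bochner_integral (lebesgue_on S) G 0"
    using assms(1) by (simp add: has_bochner_integral_restrict_space)
  then show ?thesis
    by (rule has_bochner_integral_cong[THEN iffD1, rotated 3]) (auto simp: Gw)
qed

text \<open>
  Test the equation \<open>\<nabla>\<cdot>(g\<nabla>u) = 0\<close> with the coordinate function \<open>x \<bullet> b\<close>. Pointwise,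
  \<open>\<nabla>\<cdot>((x \<bullet> b) g\<nabla>u) = (x \<bullet> b) \<nabla>\<cdot>(g\<nabla>u) + g \<partial>\<^sub>b u = g \<partial>\<^sub>b u\<close>, so
  \<open>u \<partial>\<^sub>b g = \<partial>\<^sub>b (g u) - \<nabla>\<cdot>((x \<bullet> b) g\<nabla>u)\<close> is a sum of partial derivatives of functions with
  support in \<open>K\<close>.
\<close>

lemma integral_mult_partial_eq_0:
  assumes S: "open S" and K: "compact K" "K \<subseteq> S" and b: "b \<in> Basis"
    and g: "Ck_on 1 S g" and supp: "\<And>x. x \<in> S - K \<Longrightarrow> g x = 0"
    and u: "Ck_on 1 S u" "\<And>c. c \<in> Basis \<Longrightarrow> Ck_on 1 S (partial c u)"
    and gen: "\<And>x. x \<in> S \<Longrightarrow> generator g u x = 0"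
  shows "(LINT x|lebesgue_on S. u x * partial b g x) = 0"
proof -
  let ?w = "\<lambda>c y. (y \<bullet> b) * (g y * partial c u y)"
  have "has_bochner_integral (lebesgue_on S)
      (\<lambda>x. partial b (\<lambda>y. g y * u y) x - (\<Sum>c\<in>Basis. partial c (?w c) x)) (0 - (\<Sum>c\<in>(Basis::'a set). 0))"
    by (intro has_bochner_integral_diff has_bochner_integral_sum
        has_bochner_integral_partial_compact_support[OF S K] Ck_on_1_mult Ck_on_1_inner S g u b)
      (auto simp: supp)
  moreover have "partial b (\<lambda>y. g y * u y) x - (\<Sum>c\<in>Basis. partial c (?w c) x) = u x * partial b g x"
    if x: "x \<in> S" for x
  proof -
    have d: "g differentiable (at x)" "u differentiable (at x)" "(\<lambda>y. y \<bullet> b) differentiable (at x)"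
      "c \<in> Basis \<Longrightarrow> (\<lambda>y. g y * partial c u y) differentiable (at x)" for c
      by (intro Ck_on_1_differentiable[OF S _ x] Ck_on_1_mult Ck_on_1_inner S g u; assumption)+
    have "(\<Sum>c\<in>Basis. partial c (?w c) x)
        = (\<Sum>c\<in>Basis. (x \<bullet> b) * partial c (\<lambda>y. g y * partial c u y) x + (c \<bullet> b) * (g x * partial c u x))"
      by (intro sum.cong refl) (simp add: partial_mult[OF d(3) d(4)] partial_inner)
    also have "\<dots> = (x \<bullet> b) * generator g u x + (\<Sum>c\<in>Basis. if c = b then g x * partial b u x else 0)"
      unfolding generator_eq_sum_partial sum.distrib sum_distrib_left
      using b by (intro arg_cong2[where f="(+)"] sum.cong) (auto simp: inner_Basis)
    also have "\<dots> = g x * partial b u x" using gen[OF x] b by simp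
    finally show ?thesis using partial_mult[OF d(1,2), of b] by simp
  qed
  ultimately have "has_bochner_integral (lebesgue_on S) (\<lambda>x. u x * partial b g x) 0"
    by (subst (asm) has_bochner_integral_cong) auto
  then show ?thesis by (rule has_bochner_integral_integral_eq)
qed

text \<open>
  The extension of \<open>g\<close> by zero to the whole space has zero derivative everywhere, so it is
  constant, and it vanishes outside the bounded set \<open>K\<close>.
\<close>

lemma compact_support_zero_partials_imp_zero:
  fixes g :: "'a::euclidean_space \<Rightarrow> real"
  assumes S: "open S" and K: "compact K" "K \<subseteq> S"
    and g: "Ck_on 1 S g" and supp: "\<And>x. x \<in> S - K \<Longrightarrow> g x = 0"
    and zero: "\<And>b x. b \<in> Basis \<Longrightarrow> x \<in> S \<Longrightarrow> partial b g x = 0" and x: "x \<in> S"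
  shows "g x = 0"
proof -
  define G where "G x = (if x \<in> S then g x else 0)" for x
  have G0: "G x = 0" if "x \<notin> K" for x using supp that by (auto simp: G_def)
  have openK: "open (- K)" using K(1) compact_imp_closed by blast
  have "(G has_derivative (\<lambda>h. 0)) (at x)" for x
  proof (cases "x \<in> S")
    case True
    have "(g has_derivative frechet_derivative g (at x)) (at x)"
      using Ck_on_1_differentiable[OF S g True] by (rule has_derivative_partial)
    moreover have "frechet_derivative g (at x) = (\<lambda>h. 0)"
      by (rule linear_eq_stdbasis)
        (use zero True has_derivative_linear[OF calculation] in \<open>auto simp: partial_def linear_zero\<close>)
    ultimately have "(g has_derivative (\<lambda>h. 0)) (at x)" by simp
    then show ?thesis
      by (rule has_derivative_transform_within_open[OF _ S True]) (simp add: G_def)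
  next
    case False
    then have x: "x \<in> - K" using K(2) by auto
    have "((\<lambda>x. 0) has_derivative (\<lambda>h. 0)) (at x)" by simp
    then show ?thesis
      by (rule has_derivative_transform_within_open[OF _ openK x]) (simp add: G0)
  qed
  then obtain c where c: "\<And>x. G x = c"
    using has_derivative_zero_constant[of UNIV G] by auto
  obtain z where "z \<notin> K"
    using K(1) compact_imp_bounded not_bounded_UNIV by (metis UNIV_I bounded_subset subsetI)
  then have "c = 0" using c G0 by metis
  then show ?thesis using c[of x] x by (simp add: G_def)
qed

section \<open>Spectral data determined by the transition operator\<close>

text \<open>
  The coefficients \<open>exp (- t * l j) * \<langle>e j, \<phi>\<rangle>\<close> are square summable by Bessel's inequality, so the
  spectral series converges, and the choice in \<^const>\<open>transition_op\<close> does select a sum of it. The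
  Fourier coefficients of any such sum are read off term by term.
\<close>

lemma transition_op_coefficients:
  assumes fin: "emeasure lebesgue S < \<infinity>" "S \<in> sets lebesgue"
    and on: "L2_orthonormal S e" and phi: "\<phi> \<in> L2 S" and l: "\<And>j. 0 \<le> l j" and t: "0 \<le> t"
  shows "transition_op S e l t \<phi> \<in> L2 S"
    and "L2_inner S (e k) (transition_op S e l t \<phi>) = exp (- t * l k) * L2_inner S (e k) \<phi>"
proof -
  define c where "c j = exp (- t * l j) * L2_inner S (e j) \<phi>" for j
  have e: "e j \<in> L2 S" for j using on by (auto simp: L2_orthonormal_def)
  have "summable (\<lambda>j. (c j)\<^sup>2)"
  proof (rule summable_comparison_test'[OF Bessel_inequality[OF on phi]])
    fix j
    have "\<bar>c j\<bar> \<le> 1 * \<bar>L2_inner S (e j) \<phi>\<bar>"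
      unfolding c_def abs_mult using l t by (intro mult_right_mono) auto
    then show "norm ((c j)\<^sup>2) \<le> (L2_inner S (e j) \<phi>)\<^sup>2"
      by (simp add: abs_le_square_iff)
  qed
  then obtain s where "L2_sums S (\<lambda>j x. c j * e j x) s"
    using Riesz_Fischer[OF fin on] by blast
  then have "L2_sums S (\<lambda>j x. c j * e j x) (SOME s. L2_sums S (\<lambda>j x. c j * e j x) s)"
    by (rule someI[where P = "L2_sums S (\<lambda>j x. c j * e j x)"])
  moreover have "transition_op S e l t \<phi> = (SOME s. L2_sums S (\<lambda>j x. c j * e j x) s)"
    unfolding transition_op_def c_def by (simp add: mult_ac)
  ultimately have sm: "L2_sums S (\<lambda>j x. c j * e j x) (transition_op S e l t \<phi>)" by simp
  then show "transition_op S e l t \<phi> \<in> L2 S" by (simp add: L2_sums_def)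
  have "(\<lambda>j. L2_inner S (e k) (\<lambda>x. c j * e j x)) sums L2_inner S (e k) (transition_op S e l t \<phi>)"
    by (rule L2_sums_inner[OF _ _ sm]) (auto intro: e)
  moreover have "(\<lambda>j. L2_inner S (e k) (\<lambda>x. c j * e j x)) = (\<lambda>j. if j = k then c j else 0)"
    using on by (auto simp: L2_inner_scale_right L2_orthonormal_def)
  moreover have "(\<lambda>j. if j = k then c j else 0) sums c k" by (rule sums_single)
  ultimately show "L2_inner S (e k) (transition_op S e l t \<phi>) = exp (- t * l k) * L2_inner S (e k) \<phi>"
    using sums_unique2 by (fastforce simp: c_def)
qed

text \<open>
  The eigenvalues are nonnegative because they increase from \<open>l 0 = 0\<close>, and their multiplicities are
  finite because they tend to infinity. The eigenfunctions are square integrable as uniformly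
  continuous functions on a bounded set.
\<close>

lemma neumann_eigensystemD:
  assumes "open S" "bounded S" "neumann_eigensystem S f e l"
  shows "L2_orthonormal S e" "0 \<le> l j" "finite {k. l k = L}"
    "\<phi> \<in> L2 S \<Longrightarrow> (\<And>j. L2_inner S (e j) \<phi> = 0) \<Longrightarrow> L2_eq S \<phi> (\<lambda>x. 0)"
    "Ck_unif 2 S (e j)" "x \<in> S \<Longrightarrow> generator f (e j) x = - l j * e j x"
proof -
  show C: "Ck_unif 2 S (e j)" for j using assms(3) by (auto simp: neumann_eigensystem_def)
  have "e j \<in> L2 S" for j
    using uniformly_continuous_imp_L2 assms(1,2) Ck_unif_2D(1)[OF C] by blast
  then show "L2_orthonormal S e"
    using assms(3) by (auto simp: neumann_eigensystem_def L2_orthonormal_def)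
  show "0 \<le> l j"
    using assms(3) monoD[of l 0 j] by (auto simp: neumann_eigensystem_def)
  have "\<forall>\<^sub>F k in sequentially. L < l k"
    using assms(3) by (auto simp: neumann_eigensystem_def filterlim_at_top_dense)
  then obtain N where "\<And>k. N \<le> k \<Longrightarrow> L < l k" by (auto simp: eventually_sequentially)
  then have "{k. l k = L} \<subseteq> {..<N}" by (force simp: not_le[symmetric])
  then show "finite {k. l k = L}" using finite_subset by blast
qed (use assms(3) in \<open>auto simp: neumann_eigensystem_def\<close>)

text \<open>
  Write \<open>P\<close> for the common operator. Then \<open>P (e1 j) = exp (- D * l1 j) * e1 j\<close>; comparing the
  coefficients along \<open>e2 k\<close>, those of \<open>e1 j\<close> vanish unless \<open>exp (- D * l2 k) = exp (- D * l1 j)\<close>, that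
  is, \<open>l2 k = l1 j\<close>. Only finitely many \<open>k\<close> satisfy this, so the expansion of \<open>e1 j\<close> is a finite sum;
  by continuity it holds everywhere, and it may be differentiated term by term.
\<close>

lemma eigenfunction_of_equal_transition_ops:
  assumes S: "open S" "bounded S" and D: "D > 0"
    and n1: "neumann_eigensystem S f1 e1 l1" and n2: "neumann_eigensystem S f2 e2 l2"
    and eq: "\<forall>\<phi>\<in>L2 S. L2_eq S (transition_op S e1 l1 D \<phi>) (transition_op S e2 l2 D \<phi>)"
  obtains A a where "finite A" "\<And>k. k \<in> A \<Longrightarrow> l2 k = l1 j"
    "\<And>x. x \<in> S \<Longrightarrow> e1 j x = (\<Sum>k\<in>A. a k * e2 k x)"
proof -
  note N1 = neumann_eigensystemD[OF S n1] and N2 = neumann_eigensystemD[OF S n2]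
  have fin: "emeasure lebesgue S < \<infinity>" "S \<in> sets lebesgue"
    using S emeasure_bounded_finite by auto
  have e1: "e1 k \<in> L2 S" and e2: "e2 k \<in> L2 S" for k
    using N1(1) N2(1) by (auto simp: L2_orthonormal_def)
  let ?P1 = "transition_op S e1 l1 D (e1 j)" and ?P2 = "transition_op S e2 l2 D (e1 j)"
  have P1: "?P1 \<in> L2 S"
    "L2_inner S (e1 k) ?P1 = exp (- D * l1 k) * L2_inner S (e1 k) (e1 j)" for k
    using transition_op_coefficients[OF fin N1(1) e1 N1(2)] D by auto
  have P2: "?P2 \<in> L2 S"
    "L2_inner S (e2 k) ?P2 = exp (- D * l2 k) * L2_inner S (e2 k) (e1 j)" for k
    using transition_op_coefficients[OF fin N2(1) e1 N2(2)] D by auto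
  have "L2_eq S (\<lambda>x. ?P1 x - exp (- D * l1 j) * e1 j x) (\<lambda>x. 0)"
  proof (rule N1(4))
    show "L2_inner S (e1 k) (\<lambda>x. ?P1 x - exp (- D * l1 j) * e1 j x) = 0" for k
      using N1(1) by (subst L2_inner_diff_right[OF e1 P1(1) L2_scale[OF e1]])
        (auto simp: L2_inner_scale_right P1(2) L2_orthonormal_def)
  qed (intro L2_diff P1 L2_scale e1)
  then have eig: "L2_eq S ?P1 (\<lambda>x. exp (- D * l1 j) * e1 j x)"
    by (simp add: L2_eq_def)
  have l: "l2 k = l1 j" if "L2_inner S (e2 k) (e1 j) \<noteq> 0" for k
  proof -
    have "exp (- D * l1 j) * L2_inner S (e2 k) (e1 j) = L2_inner S (e2 k) ?P1"
      using L2_inner_cong_AE[OF e2 P1(1) L2_scale[OF e1] eig] by (simp add: L2_inner_scale_right)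
    also have "\<dots> = L2_inner S (e2 k) ?P2"
      using L2_inner_cong_AE[OF e2 P1(1) P2(1)] eq e1 by blast
    finally have "exp (- D * l1 j) = exp (- D * l2 k)" using that P2(2) by simp
    then show ?thesis using D by simp
  qed
  define A where "A = {k. l2 k = l1 j}"
  define a where "a k = L2_inner S (e2 k) (e1 j)" for k
  have finA: "finite A" unfolding A_def by (rule N2(3))
  have sumL2: "(\<lambda>x. \<Sum>k\<in>A. a k * e2 k x) \<in> L2 S" by (intro L2_sum L2_scale e2)
  have "L2_eq S (\<lambda>x. e1 j x - (\<Sum>k\<in>A. a k * e2 k x)) (\<lambda>x. 0)"
  proof (rule N2(4))
    show "L2_inner S (e2 i) (\<lambda>x. e1 j x - (\<Sum>k\<in>A. a k * e2 k x)) = 0" for i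
    proof -
      have "L2_inner S (e2 i) (\<lambda>x. \<Sum>k\<in>A. a k * e2 k x) = a i"
        using l[of i] unfolding orthonormal_inner_sum[OF N2(1) finA] by (auto simp: a_def A_def)
      then show ?thesis
        using L2_inner_diff_right[OF e2 e1 sumL2, of i j] by (simp add: a_def)
    qed
  qed (intro L2_diff e1 L2_sum L2_scale e2)
  then have ae: "L2_eq S (e1 j) (\<lambda>x. \<Sum>k\<in>A. a k * e2 k x)" by (simp add: L2_eq_def)
  have c1: "continuous_on S (e1 j)"
    using Ck_unif_2D(1)[OF N1(5)] by (rule uniformly_continuous_imp_continuous)
  have "continuous_on S (e2 k)" for k
    using Ck_unif_2D(1)[OF N2(5)] by (rule uniformly_continuous_imp_continuous)
  then have c2: "continuous_on S (\<lambda>x. \<Sum>k\<in>A. a k * e2 k x)" by (intro continuous_intros)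
  have "e1 j x = (\<Sum>k\<in>A. a k * e2 k x)" if "x \<in> S" for x
    using L2_eq_continuous_imp_eq[OF S(1) c1 c2 ae that] .
  with finA show ?thesis using that by (auto simp: A_def)
qed

section \<open>Identification of the coefficient\<close>

theorem theorem1:
  fixes \<Omega> :: "'a::euclidean_space set"
    and f1 f2 :: "'a \<Rightarrow> real"
    and e1 e2 :: "nat \<Rightarrow> 'a \<Rightarrow> real"
    and l1 l2 :: "nat \<Rightarrow> real"
    and D :: real
  assumes "open \<Omega>" and "bounded \<Omega>" and "convex \<Omega>" and "smooth_boundary \<Omega>"
    and "measure lebesgue \<Omega> = 1"
    and "Ck_unif 2 \<Omega> f1" and "\<exists>m>0. \<forall>x\<in>\<Omega>. m \<le> f1 x"
    and "Ck_unif 2 \<Omega> f2" and "\<exists>m>0. \<forall>x\<in>\<Omega>. m \<le> f2 x"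
    and "\<exists>K. compact K \<and> K \<subseteq> \<Omega> \<and> (\<forall>x\<in>\<Omega> - K. f1 x = f2 x)"
    and "neumann_eigensystem \<Omega> f1 e1 l1"
    and "neumann_eigensystem \<Omega> f2 e2 l2"
    and "D > 0"
    and "\<forall>\<phi>\<in>L2 \<Omega>. L2_eq \<Omega> (transition_op \<Omega> e1 l1 D \<phi>) (transition_op \<Omega> e2 l2 D \<phi>)"
  shows "\<forall>x\<in>\<Omega>. f1 x = f2 x"
proof -
  note S = assms(1,2) and f1 = Ck_unif_2D[OF assms(6)] and f2 = Ck_unif_2D[OF assms(8)]
  note N1 = neumann_eigensystemD[OF S assms(11)] and N2 = neumann_eigensystemD[OF S assms(12)]
  obtain K where K: "compact K" "K \<subseteq> \<Omega>" "\<And>x. x \<in> \<Omega> - K \<Longrightarrow> f1 x = f2 x"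
    using assms(10) by blast
  define g where "g x = f1 x - f2 x" for x
  have g: "Ck_on 1 \<Omega> g" unfolding g_def by (intro Ck_on_1_diff S(1) f1(2) f2(2))
  have supp: "g x = 0" if "x \<in> \<Omega> - K" for x using K(3)[OF that] by (simp add: g_def)
  have gen: "generator g (e1 j) x = 0" if x: "x \<in> \<Omega>" for j x
  proof -
    obtain A a where A: "finite A" "\<And>k. k \<in> A \<Longrightarrow> l2 k = l1 j"
      "\<And>x. x \<in> \<Omega> \<Longrightarrow> e1 j x = (\<Sum>k\<in>A. a k * e2 k x)"
      using eigenfunction_of_equal_transition_ops[OF S assms(13,11,12,14)] by blast
    have "generator f2 (e1 j) x = (\<Sum>k\<in>A. a k * generator f2 (e2 k) x)"
      using A(3) by (intro generator_sum_scale[OF S(1) x f2(2)] Ck_unif_2D[OF N2(5)])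
    also have "\<dots> = (\<Sum>k\<in>A. - l1 j * (a k * e2 k x))"
      by (intro sum.cong refl) (simp add: N2(6)[OF x] A(2))
    also have "\<dots> = - l1 j * e1 j x" unfolding A(3)[OF x] by (simp only: sum_distrib_left)
    finally have "generator f2 (e1 j) x = generator f1 (e1 j) x" by (simp add: N1(6)[OF x])
    moreover have "generator g (e1 j) x = generator f1 (e1 j) x - generator f2 (e1 j) x"
      unfolding g_def by (intro generator_diff[OF S(1) x f1(2) f2(2)] Ck_unif_2D[OF N1(5)])
    ultimately show ?thesis by simp
  qed
  have zero: "partial b g x = 0" if b: "b \<in> Basis" and x: "x \<in> \<Omega>" for b x
  proof -
    have "uniformly_continuous_on \<Omega> (\<lambda>x. partial b f1 x - partial b f2 x)"
      using f1(3)[OF b] f2(3)[OF b] by (rule uniformly_continuous_on_diff)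
    moreover have "partial b g x = partial b f1 x - partial b f2 x" if "x \<in> \<Omega>" for x
      unfolding g_def by (intro partial_diff Ck_on_1_differentiable[OF S(1) _ that] f1(2) f2(2))
    ultimately have uc: "uniformly_continuous_on \<Omega> (partial b g)"
      by (simp add: uniformly_continuous_on_def)
    have "L2_eq \<Omega> (partial b g) (\<lambda>x. 0)"
    proof (rule N1(4))
      show "partial b g \<in> L2 \<Omega>" by (rule uniformly_continuous_imp_L2[OF S uc])
      show "L2_inner \<Omega> (e1 j) (partial b g) = 0" for j
        unfolding L2_inner_def
        by (rule integral_mult_partial_eq_0[OF S(1) K(1,2) b g supp])
          (use Ck_unif_2D[OF N1(5)] gen in auto)
    qed
    then show ?thesis
      by (intro L2_eq_continuous_imp_eq[OF S(1) uniformly_continuous_imp_continuous[OF uc] _ _ x]) auto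
  qed
  have "g x = 0" if "x \<in> \<Omega>" for x
    by (rule compact_support_zero_partials_imp_zero[OF S(1) K(1,2) g supp zero that])
  then show ?thesis by (simp add: g_def)
qed

end
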